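(* Let $\gamma$ be an ordinal, let $A$ be a set, and let $X\subseteq {}^{\gamma}A$ be a subspace (with respect to the bounded topology) whose weight is a cardinal $\lambda\geq\mathfrak{c}=2^{\aleph_0}$. Then there is no continuous weak $\lambda^+$-measure space $(X,\mathfrak{M},\mu)$; that is, for no positively totally ordered monoid $\mathbb{S}$ with an infinitary sum $\mathsf{Sum}$ is there a continuous weak $\lambda^+$-measure space $(X,\mathfrak{M},\mu)$ with $\mu$ taking values in $(\mathbb{S},\mathsf{Sum})$.
   Context: **Topology.** ${}^{\gamma}A$ is the set of sequences of elements of $A$ of length $\gamma$, with the bounded topology, generated by the cones $\mathbf{N}_s=\{x\in{}^{\gamma}A\mid s\subseteq x\}$ for $s\in{}^{<\gamma}A=\bigcup_{\alpha<\gamma}{}^{\alpha}A$. Subsets carry the subspace topology. The weight of a space is the minimal size of a basis. **Monoids and sums.** A positively totally ordered monoid is $\mathbb{S}=(S,0,+,\leq)$ where $+$ is associative (not necessarily commutative) with neutral element $0$, $\leq$ is a total order, $a\leq b$ and $c\leq d$ imply $a+c\leq b+d$, $0$ is the minimum of $\leq$, and $S\neq\{0\}$. ${}^{<\mathrm{On}}\mathbb{S}$ is the class of all sequences of elements of $S$ of ordinal length; $\mathrm{lh}(s)$ is the length of $s$. An infinitary sum on $\mathbb{S}$ is a partial function $\mathsf{Sum}:{}^{<\mathrm{On}}\mathbb{S}\to\mathbb{S}$ such that: (S1) $\mathsf{Sum}(\emptyset)=0$ and $\mathsf{Sum}(s)=s_0+\dots+s_n$ for every non-empty finite $s=(s_i)_{i\leq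 n}\in\mathrm{dom}(\mathsf{Sum})$; (S2) (continuity) for all $s\in\mathrm{dom}(\mathsf{Sum})$ of limit length, if $s\restriction\alpha\in\mathrm{dom}(\mathsf{Sum})$ for cofinally many $\alpha<\mathrm{lh}(s)$, then $\mathsf{Sum}(s)=\sup\{\mathsf{Sum}(s\restriction\alpha)\mid\alpha<\mathrm{lh}(s),\ s\restriction\alpha\in\mathrm{dom}(\mathsf{Sum})\}$. **Measures.** A weakly $\lambda^+$-measurable space is a pair $(X,\mathfrak{M})$ where $X$ is a topological space and $\mathfrak{M}$ is a family of subsets of $X$ closed under unions of size $\leq\lambda$ and containing all open subsets of $X$. A $\lambda^+$-measure on it (with values in $(\mathbb{S},\mathsf{Sum})$) is a partial function $\mu:\mathscr{P}(X)\to\mathbb{S}$ with $\mathfrak{M}\subseteq\mathrm{dom}(\mu)$ such that: (M1) $\mu(\emptyset)=0$; (M2) $\mu(X)>0$; (M3) $A\subseteq B$ implies $\mu(A)\leq\mu(B)$ for all $A,B\in\mathfrak{M}$; (M4) for every family $(A_i)_{i<\gamma}$ of pairwise disjoint sets of $\mathfrak{M}$ of length an ordinal $\gamma<\lambda^+$, we have $\langle\mu(A_i)\mid i<\gamma\rangle\in\mathrm{dom}(\mathsf{Sum})$ and $\mu(\bigcup_{i<\gamma}A_i)=\mathsf{Sum}(\langle\mu(A_i)\mid i<\gamma\rangle)$; (M5) for every $x\in X$ with $\{x\}\in\mathfrak{M}$ and every open local basis $\{A_i\mid i<\gamma\}$ at $x$ with $\gamma<\lambda^+$, $\mu(\{x\})=\inf_{i<\gamma}\mu(A_i)$.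 Then $(X,\mathfrak{M},\mu)$ is called a weak $\lambda^+$-measure space. It is continuous if $\{x\}\in\mathfrak{M}$ and $\mu(\{x\})=0$ for every $x\in X$. *)

theory Defs
  imports "HOL-Analysis.Analysis" "HOL-Library.Lub_Glb"
begin

unbundle cardinal_syntax

section \<open>Ordinals and sequences of ordinal length\<close>

text \<open>
  The class of all ordinals is represented by an arbitrary well-ordered type \<open>'o\<close>: an element
  \<open>\<alpha>\<close> stands for the ordinal that is the order type of \<open>{..<\<alpha>}\<close>. Since the main statement is
  polymorphic in \<open>'o\<close>, this covers all ordinals; it only asks that \<open>'o\<close> be long enough for the
  ordinals below \<open>\<kappa>\<^sup>+\<close>, over which measures quantify, to be among those represented.
  A sequence of length \<open>\<alpha>\<close> is a partial function with domain \<open>{..<\<alpha>}\<close>; thus sequence extension is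
  \<open>\<subseteq>\<^sub>m\<close>, and the initial segment of length \<open>\<beta>\<close> of \<open>s\<close> is \<open>s |` {..<\<beta>}\<close>.
\<close>

definition ord_of :: "'o::wellorder \<Rightarrow> 'o rel" where
  "ord_of \<alpha> = {(\<beta>, \<delta>). \<beta> \<le> \<delta> \<and> \<delta> < \<alpha>}"

definition all_ords :: "'o::wellorder rel" where
  "all_ords = {(\<beta>, \<delta>). \<beta> \<le> \<delta>}"

definition seqs :: "'o::wellorder \<Rightarrow> 'a set \<Rightarrow> ('o \<rightharpoonup> 'a) set" where
  "seqs \<alpha> A = {s. dom s = {..<\<alpha>} \<and> ran s \<subseteq> A}"

definition limit_ord :: "'o::wellorder \<Rightarrow> bool" where
  "limit_ord \<alpha> \<longleftrightarrow> {..<\<alpha>} \<noteq> {} \<and> (\<forall>\<beta><\<alpha>. \<exists>\<delta><\<alpha>. \<beta> < \<delta>)"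

section \<open>The bounded topology and weight\<close>

definition cone :: "'o::wellorder \<Rightarrow> 'a set \<Rightarrow> ('o \<rightharpoonup> 'a) \<Rightarrow> ('o \<rightharpoonup> 'a) set" where
  "cone \<gamma> A s = {x \<in> seqs \<gamma> A. s \<subseteq>\<^sub>m x}"

text \<open>
  For \<open>\<gamma> > 0\<close> the whole space is the cone of the empty sequence; it is inserted explicitly so that
  the carrier is also right for \<open>\<gamma> = 0\<close>, where there are no cones.
\<close>

definition bounded_topology :: "'o::wellorder \<Rightarrow> 'a set \<Rightarrow> ('o \<rightharpoonup> 'a) topology" where
  "bounded_topology \<gamma> A =
     topology_generated_by (insert (seqs \<gamma> A) {cone \<gamma> A s | s. \<exists>\<alpha><\<gamma>. s \<in> seqs \<alpha> A})"

definition topology_basis :: "'p topology \<Rightarrow> 'p set set \<Rightarrow> bool" where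
  "topology_basis T \<B> \<longleftrightarrow>
     (\<forall>V\<in>\<B>. openin T V) \<and> (\<forall>U x. openin T U \<and> x \<in> U \<longrightarrow> (\<exists>V\<in>\<B>. x \<in> V \<and> V \<subseteq> U))"

definition has_weight :: "'p topology \<Rightarrow> 'l rel \<Rightarrow> bool" where
  "has_weight T \<kappa> \<longleftrightarrow> Card_order \<kappa> \<and>
     (\<exists>\<B>. topology_basis T \<B> \<and> |\<B>| =o \<kappa>) \<and> (\<forall>\<B>. topology_basis T \<B> \<longrightarrow> \<kappa> \<le>o |\<B>| )"

definition open_local_basis :: "'p topology \<Rightarrow> 'p \<Rightarrow> 'p set set \<Rightarrow> bool" where
  "open_local_basis T x \<B> \<longleftrightarrow>
     (\<forall>V\<in>\<B>. openin T V \<and> x \<in> V) \<and> (\<forall>U. openin T U \<and> x \<in> U \<longrightarrow> (\<exists>V\<in>\<B>. V \<subseteq> U))"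

section \<open>Positively totally ordered monoids and infinitary sums\<close>

class pos_tot_ordered_monoid = monoid_add + linorder +
  assumes plus_mono: "a \<le> b \<Longrightarrow> c \<le> d \<Longrightarrow> a + c \<le> b + d"
    and zero_least: "0 \<le> a"
    and nontrivial: "\<exists>a. a \<noteq> 0"

locale infinitary_sum =
  fixes Sum :: "('o::wellorder \<rightharpoonup> 's::pos_tot_ordered_monoid) \<rightharpoonup> 's"
  assumes dom_Sum: "dom Sum \<subseteq> (\<Union>\<alpha>. seqs \<alpha> UNIV)"
    and S1_empty: "Sum Map.empty = Some 0"
    and S1_finite: "\<And>s. s \<in> dom Sum \<Longrightarrow> s \<noteq> Map.empty \<Longrightarrow> finite (dom s) \<Longrightarrow>
      Sum s = Some (sum_list (map (\<lambda>i. the (s i)) (sorted_list_of_set (dom s))))"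
    and S2: "\<And>s \<alpha>. s \<in> dom Sum \<Longrightarrow> dom s = {..<\<alpha>} \<Longrightarrow> limit_ord \<alpha> \<Longrightarrow>
      (\<forall>\<beta><\<alpha>. \<exists>\<delta><\<alpha>. \<beta> \<le> \<delta> \<and> s |` {..<\<delta>} \<in> dom Sum) \<Longrightarrow>
      isLub UNIV {the (Sum (s |` {..<\<delta>})) | \<delta>. \<delta> < \<alpha> \<and> s |` {..<\<delta>} \<in> dom Sum} (the (Sum s))"

section \<open>Measures\<close>

text \<open>
  The parameter \<open>\<kappa>\<close> is a cardinal given as a relation, \<open>T\<close> is the topology of the underlying space
  \<open>topspace T\<close>, and \<open>cardSuc \<kappa>\<close> is \<open>\<kappa>\<^sup>+\<close>.
\<close>

locale weakly_measurable_space =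
  fixes \<kappa> :: "'l rel" and T :: "'p topology" and \<MM> :: "'p set set"
  assumes sets_subset: "\<MM> \<subseteq> Pow (topspace T)"
    and union_closed: "\<And>\<U>. \<U> \<subseteq> \<MM> \<Longrightarrow> |\<U>| \<le>o \<kappa> \<Longrightarrow> \<Union>\<U> \<in> \<MM>"
    and open_sets: "\<And>U. openin T U \<Longrightarrow> U \<in> \<MM>"

locale weak_measure_space =
  weakly_measurable_space \<kappa> T \<MM> + infinitary_sum Sum
  for \<kappa> :: "'l rel" and T :: "'p topology" and \<MM> :: "'p set set"
    and Sum :: "('o::wellorder \<rightharpoonup> 's::pos_tot_ordered_monoid) \<rightharpoonup> 's" +
  fixes \<mu> :: "'p set \<rightharpoonup> 's"
  assumes dom_measure: "dom \<mu> \<subseteq> Pow (topspace T)"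
    and sets_in_dom: "\<MM> \<subseteq> dom \<mu>"
    and M1: "\<mu> {} = Some 0"
    and M2: "the (\<mu> (topspace T)) > 0"
    and M3: "\<And>A B. A \<in> \<MM> \<Longrightarrow> B \<in> \<MM> \<Longrightarrow> A \<subseteq> B \<Longrightarrow> the (\<mu> A) \<le> the (\<mu> B)"
    and M4: "\<And>(\<alpha>::'o) A. ord_of \<alpha> <o cardSuc \<kappa> \<Longrightarrow> (\<forall>i<\<alpha>. A i \<in> \<MM>) \<Longrightarrow>
      disjoint_family_on A {..<\<alpha>} \<Longrightarrow>
      (\<lambda>i. \<mu> (A i)) |` {..<\<alpha>} \<in> dom Sum \<and>
      \<mu> (\<Union>i<\<alpha>. A i) = Sum ((\<lambda>i. \<mu> (A i)) |` {..<\<alpha>})"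
    and M5: "\<And>x (\<alpha>::'o) A. x \<in> topspace T \<Longrightarrow> {x} \<in> \<MM> \<Longrightarrow> ord_of \<alpha> <o cardSuc \<kappa> \<Longrightarrow>
      open_local_basis T x (A ` {..<\<alpha>}) \<Longrightarrow>
      isGlb UNIV ((\<lambda>i. the (\<mu> (A i))) ` {..<\<alpha>}) (the (\<mu> {x}))"

locale continuous_weak_measure_space = weak_measure_space +
  assumes continuous: "\<And>x. x \<in> topspace T \<Longrightarrow> {x} \<in> \<MM> \<and> \<mu> {x} = Some 0"

end

theory Submission
  imports Defs
begin

text \<open>
  By S2 and rearrangement, the measure of a disjoint union of at most \<open>\<kappa>\<close> sets is the supremum of the
  measures of the finite subunions. Every point has cylinders of arbitrarily small measure, and
  cylinders form a tree, so for every \<open>b > 0\<close> the space is partitioned into cylinders of measure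
  below \<open>b\<close>; hence \<open>\<mu>(X)\<close> is at most any bound of the finite multiples of \<open>b\<close>. Consequently a cylinder
  \<open>N\<close> with \<open>\<mu>(N) < \<mu>(X)\<close> contains no infinite disjoint family of sets of measure at least \<open>b\<close>.
  Choose \<open>N\<close> around a point of the support. The differences of cylinders shrinking to that point
  give a sequence of positive values with infimum \<open>0\<close>, so the partitions of \<open>N\<close> at these scales have
  only countably many cylinders of positive measure. These separate the points of the support in
  \<open>N\<close>, of which there are thus at most continuum many, so that they form a null set, as do the
  remaining points of \<open>N\<close>: a contradiction.
\<close>

section \<open>Cylinders in the bounded topology\<close>

text \<open>The trace of a cone on \<open>X\<close>, indexed by a point and a length instead of a
  partial sequence. Cylinders of equal length that meet coincide.\<close>

definition cyl :: "('o::wellorder \<rightharpoonup> 'a) set \<Rightarrow> ('o \<rightharpoonup> 'a) \<Rightarrow> 'o \<Rightarrow> ('o \<rightharpoonup> 'a) set" where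
  "cyl X x \<alpha> = {y \<in> X. \<forall>i<\<alpha>. y i = x i}"

lemma cyl_subset: "cyl X x \<alpha> \<subseteq> X"
  by (auto simp: cyl_def)

lemma mem_cyl: "x \<in> X \<Longrightarrow> x \<in> cyl X x \<alpha>"
  by (auto simp: cyl_def)

lemma cyl_eq: "y \<in> cyl X x \<alpha> \<Longrightarrow> cyl X y \<alpha> = cyl X x \<alpha>"
  by (auto simp: cyl_def)

lemma cyl_antimono: "\<alpha> \<le> \<beta> \<Longrightarrow> cyl X x \<beta> \<subseteq> cyl X x \<alpha>"
  by (auto simp: cyl_def)

lemma cone_Int_eq_cyl:
  assumes "X \<subseteq> seqs \<gamma> A" "x \<in> X" "\<alpha> < \<gamma>"
  shows "cone \<gamma> A (x |` {..<\<alpha>}) \<inter> X = cyl X x \<alpha>"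
proof -
  have "{..<\<alpha>} \<subseteq> dom x"
    using assms by (auto simp: seqs_def subset_iff)
  hence "(x |` {..<\<alpha>} \<subseteq>\<^sub>m y) \<longleftrightarrow> (\<forall>i<\<alpha>. y i = x i)" for y
    by (auto simp: map_le_def restrict_map_def dom_def)
  thus ?thesis
    using assms(1) by (auto simp: cone_def cyl_def)
qed

lemma topspace_bounded_topology: "topspace (bounded_topology \<gamma> A) = seqs \<gamma> A"
  by (auto simp: bounded_topology_def cone_def)

lemma topspace_subtopology_bounded:
  "X \<subseteq> seqs \<gamma> A \<Longrightarrow> topspace (subtopology (bounded_topology \<gamma> A) X) = X"
  by (simp add: topspace_bounded_topology Int_absorb1)

lemma openin_cyl:
  assumes "X \<subseteq> seqs \<gamma> A" "x \<in> X" "\<alpha> < \<gamma>"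
  shows "openin (subtopology (bounded_topology \<gamma> A) X) (cyl X x \<alpha>)"
proof -
  have "dom x = {..<\<gamma>}" "ran x \<subseteq> A"
    using assms by (auto simp: seqs_def)
  moreover have "ran (x |` {..<\<alpha>}) \<subseteq> ran x"
    by (auto simp: ran_def restrict_map_def)
  ultimately have "x |` {..<\<alpha>} \<in> seqs \<alpha> A"
    using assms(3) by (auto simp: seqs_def)
  hence "openin (bounded_topology \<gamma> A) (cone \<gamma> A (x |` {..<\<alpha>}))"
    unfolding bounded_topology_def using assms(3)
    by (intro topology_generated_by_Basis) auto
  thus ?thesis
    using cone_Int_eq_cyl[OF assms] by (auto simp: openin_subtopology)
qed

text \<open>Cylinders at \<open>x\<close> are nested, so the longer of two serves an intersection.
  The element \<open>\<epsilon>\<close> witnesses \<gamma> > 0: inside the generator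
  \<open>seqs \<gamma> A\<close> some length below \<gamma> has to be named.\<close>

lemma bounded_topology_contains_cyl:
  assumes "openin (bounded_topology \<gamma> A) U" "x \<in> U" "\<epsilon> < \<gamma>"
  shows "\<exists>\<alpha><\<gamma>. cyl (seqs \<gamma> A) x \<alpha> \<subseteq> U"
proof -
  have "generate_topology_on (insert (seqs \<gamma> A) {cone \<gamma> A s | s. \<exists>\<alpha><\<gamma>. s \<in> seqs \<alpha> A}) U"
    using assms(1) by (simp add: bounded_topology_def openin_topology_generated_by_iff)
  thus ?thesis using assms(2)
  proof (induction rule: generate_topology_on.induct)
    case Empty
    thus ?case by simp
  next
    case (Int U V)
    then obtain \<alpha> \<beta> where "\<alpha> < \<gamma>" "\<beta> < \<gamma>" "cyl (seqs \<gamma> A) x \<alpha> \<subseteq> U" "cyl (seqs \<gamma> A) x \<beta> \<subseteq> V"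
      by blast
    thus ?case
      by (intro exI[of _ "max \<alpha> \<beta>"]) (auto simp: cyl_def subset_iff less_max_iff_disj)
  next
    case (UN K)
    thus ?case by blast
  next
    case (Basis S)
    consider "S = seqs \<gamma> A" | s \<alpha> where "S = cone \<gamma> A s" "\<alpha> < \<gamma>" "s \<in> seqs \<alpha> A"
      using Basis.hyps by blast
    thus ?case
    proof cases
      case 1
      thus ?thesis using assms(3) cyl_subset by blast
    next
      case 2
      have "cyl (seqs \<gamma> A) x \<alpha> \<subseteq> S"
        using 2 Basis.prems by (force simp: cyl_def cone_def map_le_def seqs_def)
      thus ?thesis using 2 by blast
    qed
  qed
qed

lemma open_contains_cyl:
  assumes "X \<subseteq> seqs \<gamma> A" "openin (subtopology (bounded_topology \<gamma> A) X) U" "x \<in> U" "\<epsilon> < \<gamma>"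
  shows "\<exists>\<alpha><\<gamma>. cyl X x \<alpha> \<subseteq> U"
proof -
  obtain V where V: "openin (bounded_topology \<gamma> A) V" "U = V \<inter> X"
    using assms(2) by (auto simp: openin_subtopology)
  then obtain \<alpha> where "\<alpha> < \<gamma>" "cyl (seqs \<gamma> A) x \<alpha> \<subseteq> V"
    using bounded_topology_contains_cyl assms(3,4) by blast
  thus ?thesis
    using V assms(1) by (intro exI[of _ \<alpha>]) (auto simp: cyl_def)
qed

text \<open>Each point takes its shortest cylinder satisfying \<open>Q\<close>. Cylinders that meet
  are nested, so by minimality two chosen ones that meet are equal.\<close>

lemma cyl_partition:
  fixes \<gamma> :: "'o::wellorder"
  assumes "W \<subseteq> X" and "\<forall>x\<in>W. \<exists>\<alpha><\<gamma>. Q (cyl X x \<alpha>)"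
  shows "\<exists>P. (\<forall>x\<in>W. x \<in> P x \<and> Q (P x) \<and> (\<exists>\<alpha><\<gamma>. P x = cyl X x \<alpha>)) \<and> disjoint (P ` W)"
proof -
  define r where "r x = (LEAST \<alpha>. \<alpha> < \<gamma> \<and> Q (cyl X x \<alpha>))" for x
  have r: "r x < \<gamma> \<and> Q (cyl X x (r x))" if "x \<in> W" for x
    unfolding r_def using bspec[OF assms(2) that] by (rule LeastI_ex)
  have least: "r x \<le> \<alpha>" if "\<alpha> < \<gamma>" "Q (cyl X x \<alpha>)" for x \<alpha>
    unfolding r_def using that by (intro Least_le) simp
  \<comment> \<open>If \<open>r y < r x\<close>, the cylinder of length \<open>r y\<close> at
    \<open>x\<close> also contains \<open>z\<close>, so it equals the one at \<open>y\<close> and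
    satisfies \<open>Q\<close>, against the minimality of \<open>r x\<close>.\<close>
  have same: "r x \<le> r y"
    if "x \<in> W" "y \<in> W" "z \<in> cyl X x (r x)" "z \<in> cyl X y (r y)" for x y z
  proof (rule ccontr)
    assume "\<not> r x \<le> r y"
    hence "cyl X x (r x) \<subseteq> cyl X x (r y)"
      by (intro cyl_antimono) simp
    hence "z \<in> cyl X x (r y)"
      using that(3) by blast
    hence "cyl X x (r y) = cyl X y (r y)"
      using that(4) cyl_eq by metis
    thus False
      using least r that(2) \<open>\<not> r x \<le> r y\<close> by metis
  qed
  show ?thesis
  proof (intro exI conjI ballI)
    fix x assume "x \<in> W"
    thus "x \<in> cyl X x (r x)" "Q (cyl X x (r x))" "r x < \<gamma>" "cyl X x (r x) = cyl X x (r x)"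
      using r mem_cyl assms(1) by blast+
  next
    show "disjoint ((\<lambda>x. cyl X x (r x)) ` W)"
    proof (clarsimp simp: pairwise_def disjnt_iff)
      fix x y z assume "x \<in> W" "y \<in> W" "cyl X x (r x) \<noteq> cyl X y (r y)"
        "z \<in> cyl X x (r x)" "z \<in> cyl X y (r y)"
      moreover from this have "r x = r y"
        by (meson order_antisym same)
      ultimately show False
        using cyl_eq by metis
    qed
  qed
qed

text \<open>Cellularity is at most weight: choosing a nonempty basic set inside each member is
  injective by disjointness.\<close>

lemma disjoint_open_card_le_weight:
  assumes "has_weight T \<kappa>" "disjoint \<F>" "\<And>F. F \<in> \<F> \<Longrightarrow> openin T F \<and> F \<noteq> {}"
  shows "|\<F>| \<le>o \<kappa>"
proof -
  obtain \<B> where \<B>: "topology_basis T \<B>" "|\<B>| =o \<kappa>"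
    using assms(1) by (auto simp: has_weight_def)
  have "\<exists>V\<in>\<B>. V \<noteq> {} \<and> V \<subseteq> F" if "F \<in> \<F>" for F
  proof -
    have "F \<noteq> {}" using assms(3) that by blast
    then obtain x where "x \<in> F" by blast
    thus ?thesis using assms(3)[OF that] \<B>(1) unfolding topology_basis_def by blast
  qed
  then obtain v where v: "\<And>F. F \<in> \<F> \<Longrightarrow> v F \<in> \<B> \<and> v F \<noteq> {} \<and> v F \<subseteq> F"
    by metis
  have "inj_on v \<F>"
  proof (rule inj_onI, rule ccontr)
    fix F G assume *: "F \<in> \<F>" "G \<in> \<F>" "v F = v G" "F \<noteq> G"
    hence "F \<inter> G = {}"
      using assms(2) by (auto simp: pairwise_def disjnt_def)
    thus False using v[OF *(1)] v[OF *(2)] *(3) by auto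
  qed
  hence "|\<F>| \<le>o |\<B>|"
    using v by (intro card_of_ordLeqI) auto
  thus ?thesis using \<B>(2) ordLeq_ordIso_trans by blast
qed

text \<open>Number the members of \<C>; a point is coded by the set of numbers of the members
  containing it, and separation makes the code injective.\<close>

lemma card_le_continuum:
  assumes "countable \<C>" "\<And>y z. y \<in> Y \<Longrightarrow> z \<in> Y \<Longrightarrow> \<forall>C\<in>\<C>. y \<in> C \<longleftrightarrow> z \<in> C \<Longrightarrow> y = z"
  shows "|Y| \<le>o ctwo ^c natLeq"
proof -
  define g where "g y n = (\<exists>C\<in>\<C>. to_nat_on \<C> C = n \<and> y \<in> C)" for y n
  have "inj_on g Y"
  proof (rule inj_onI)
    fix y z assume yz: "y \<in> Y" "z \<in> Y" "g y = g z"
    have "w \<in> C \<longleftrightarrow> g w (to_nat_on \<C> C)" if "C \<in> \<C>" for w C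
      using that inj_on_to_nat_on[OF assms(1)] by (auto simp: g_def inj_on_def)
    thus "y = z" using assms(2) yz by metis
  qed
  moreover have "g ` Y \<subseteq> Func (Field natLeq) (Field ctwo)"
    by (auto simp: Func_def ctwo_def Field_natLeq Field_card_of)
  ultimately show ?thesis
    unfolding cexp_def by (intro card_of_ordLeqI) auto
qed

section \<open>Measures of disjoint unions\<close>

lemma Field_all_ords: "Field (all_ords :: 'o::wellorder rel) = UNIV"
  by (auto simp: all_ords_def Field_def)

lemma Field_ord_of: "Field (ord_of \<alpha>) = {..<\<alpha>}"
  by (auto simp: ord_of_def Field_def)

lemma underS_all_ords: "underS all_ords \<alpha> = {..<\<alpha>}"
  by (auto simp: all_ords_def underS_def)

lemma Restr_all_ords: "Restr all_ords {..<\<alpha>} = ord_of \<alpha>"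
  by (auto simp: all_ords_def ord_of_def)

lemma Well_order_all_ords: "Well_order (all_ords :: 'o::wellorder rel)"
proof -
  have "all_ords - Id = {(x, y :: 'o). x < y}"
    by (auto simp: all_ords_def)
  hence "wf (all_ords - Id :: 'o rel)"
    using wf by simp
  moreover have "linear_order_on UNIV (all_ords :: 'o rel)"
    unfolding linear_order_on_def partial_order_on_def preorder_on_def all_ords_def
    by (auto simp: refl_on_def total_on_def intro: transI antisymI)
  ultimately show ?thesis
    by (simp add: well_order_on_def Field_all_ords)
qed

lemma Well_order_ord_of: "Well_order (ord_of \<alpha>)"
  using Well_order_Restr[OF Well_order_all_ords] Restr_all_ords by metis

text \<open>Turns a cardinality bound into the bound on order types that M4 and M5 demand: otherwise
  \<open>cardSuc \<kappa>\<close> would have size at most \<kappa>.\<close>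

lemma ord_of_less_cardSuc:
  assumes "Card_order \<kappa>" "|{..<\<alpha>}| \<le>o \<kappa>"
  shows "ord_of \<alpha> <o cardSuc \<kappa>"
proof (rule ccontr)
  assume "\<not> ?thesis"
  hence "cardSuc \<kappa> \<le>o ord_of \<alpha>"
    using assms(1) cardSuc_Card_order Well_order_ord_of
    by (metis card_order_on_well_order_on not_ordLess_iff_ordLeq)
  hence "|Field (cardSuc \<kappa>)| \<le>o |{..<\<alpha>}|"
    using card_of_mono2 Field_ord_of by metis
  hence "cardSuc \<kappa> \<le>o \<kappa>"
    using assms card_of_Field_ordIso[OF cardSuc_Card_order[OF assms(1)]]
    by (meson ordIso_ordLeq_trans ordIso_symmetric ordLeq_transitive)
  thus False
    using cardSuc_greater[OF assms(1)] not_ordLess_ordLeq by blast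
qed

definition multiple :: "nat \<Rightarrow> 's::monoid_add \<Rightarrow> 's" where
  "multiple n b = ((+) b ^^ n) 0"

lemma multiple_0 [simp]: "multiple 0 b = 0"
  and multiple_Suc [simp]: "multiple (Suc n) b = b + multiple n b"
  by (simp_all add: multiple_def)

lemma multiple_zero [simp]: "multiple n (0::'s::monoid_add) = 0"
  by (induction n) auto

locale long_weak_measure_space = weak_measure_space \<kappa> T \<MM> Sum \<mu>
  for \<kappa> :: "'l rel" and T :: "'p topology" and \<MM> :: "'p set set"
    and Sum :: "('o::wellorder \<rightharpoonup> 's::pos_tot_ordered_monoid) \<rightharpoonup> 's" and \<mu> :: "'p set \<rightharpoonup> 's" +
  assumes card_\<kappa>: "Card_order \<kappa>"
    and infinite_\<kappa>: "natLeq \<le>o \<kappa>"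
    and enough_ords: "cardSuc \<kappa> \<le>o (all_ords :: 'o rel)"
begin

section \<open>Enumerations, finite additivity and suprema of finite subunions\<close>

abbreviation m :: "'p set \<Rightarrow> 's" where
  "m A \<equiv> the (\<mu> A)"

lemma finite_card_le: "finite F \<Longrightarrow> |F| \<le>o \<kappa>"
  using infinite_\<kappa> by (meson finite_iff_ordLess_natLeq ordLess_imp_ordLeq ordLeq_transitive)

text \<open>Makes M4, which speaks of sequences, applicable to any family of size at most \<kappa>:
  such a size is below \<open>cardSuc \<kappa>\<close>, hence by \<open>enough_ords\<close> that of
  an initial segment of \<open>'o\<close>.\<close>

lemma ordinal_enumeration:
  assumes "|F| \<le>o \<kappa>"
  obtains \<alpha> :: 'o and f where "|{..<\<alpha>}| \<le>o \<kappa>" "bij_betw f {..<\<alpha>} F"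
proof -
  have "|F| <o cardSuc \<kappa>"
    using assms cardSuc_greater[OF card_\<kappa>] ordLeq_ordLess_trans by blast
  hence "|F| <o (all_ords :: 'o rel)"
    using enough_ords ordLess_ordLeq_trans by blast
  then obtain \<alpha> :: 'o where "|F| =o Restr all_ords (underS all_ords \<alpha>)"
    using ordLess_iff_ordIso_Restr[OF Well_order_all_ords card_of_Well_order] by blast
  hence "ord_of \<alpha> =o |F|"
    by (simp add: underS_all_ords Restr_all_ords ordIso_symmetric)
  then obtain f where "iso (ord_of \<alpha>) |F| f"
    by (auto simp: ordIso_def)
  hence f: "bij_betw f {..<\<alpha>} F"
    by (simp add: iso_def Field_ord_of Field_card_of)
  hence "|{..<\<alpha>}| =o |F|"
    using card_of_ordIso by blast
  thus thesis
    using that f assms ordIso_ordLeq_trans by blast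
qed

lemma measure_Un:
  assumes "B \<in> \<MM>" "C \<in> \<MM>" "B \<inter> C = {}"
  shows "m (B \<union> C) = m B + m C"
proof -
  \<comment> \<open>Enumerating the two truth values yields the ordinal 2 inside
    \<open>'o\<close>.\<close>
  obtain \<alpha> :: 'o and f :: "'o \<Rightarrow> bool" where \<alpha>: "|{..<\<alpha>}| \<le>o \<kappa>" "bij_betw f {..<\<alpha>} UNIV"
    using ordinal_enumeration[of "UNIV :: bool set"] finite_card_le finite by metis
  hence "card {..<\<alpha>} = 2"
    using bij_betw_same_card by fastforce
  then obtain p q where pq: "{..<\<alpha>} = {p, q}" "p < q"
    by (metis card_2_iff insert_commute linorder_less_linear)
  define D where "D i = (if i = p then B else C)" for i
  have "\<forall>i<\<alpha>. D i \<in> \<MM>"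
    using assms by (simp add: D_def)
  moreover have "disjoint_family_on D {..<\<alpha>}"
    using assms(3) pq by (auto simp: D_def disjoint_family_on_def)
  ultimately have D: "(\<lambda>i. \<mu> (D i)) |` {..<\<alpha>} \<in> dom Sum"
    "\<mu> (\<Union>i<\<alpha>. D i) = Sum ((\<lambda>i. \<mu> (D i)) |` {..<\<alpha>})"
    using M4[OF ord_of_less_cardSuc[OF card_\<kappa> \<alpha>(1)], of D] by blast+
  let ?s = "(\<lambda>i. \<mu> (D i)) |` {..<\<alpha>}"
  \<comment> \<open>An undefined value would shrink the domain of the restricted map; here S1 sees
    exactly two summands, in the order \<open>p < q\<close>.\<close>
  have "\<mu> (D i) \<noteq> None" for i
    using sets_in_dom assms by (auto simp: D_def)
  hence dom: "dom ?s = {p, q}"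
    by (auto simp: pq dom_def restrict_map_def)
  have "Sum ?s = Some (sum_list (map (\<lambda>i. the (?s i)) (sorted_list_of_set (dom ?s))))"
    using dom by (intro S1_finite[OF D(1)]) (metis dom_empty insert_not_empty, simp)
  also have "sorted_list_of_set (dom ?s) = [p, q]"
    unfolding dom using pq(2) by (simp add: less_imp_le)
  also have "sum_list (map (\<lambda>i. the (?s i)) [p, q]) = m B + m C"
    using pq(2) by (auto simp: D_def pq(1))
  also have "(\<Union>i<\<alpha>. D i) = B \<union> C"
    using pq by (auto simp: D_def)
  ultimately show ?thesis
    using D(2) by simp
qed

text \<open>
  The measure of the union does not depend on the order of the family, so the family may be
  indexed by the least ordinal of its cardinality; if infinite, this is a limit and S2 applies.
\<close>

lemma measure_UN_le:
  assumes "|{..<\<alpha>::'o}| \<le>o \<kappa>" "\<forall>i<\<alpha>. D i \<in> \<MM>" "disjoint_family_on D {..<\<alpha>}"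
    and "\<And>J. finite J \<Longrightarrow> J \<subseteq> {..<\<alpha>} \<Longrightarrow> m (\<Union>i\<in>J. D i) \<le> b"
  shows "m (\<Union>i<\<alpha>. D i) \<le> b"
  using assms
proof (induction \<alpha> arbitrary: D rule: less_induct)
  case (less \<alpha>)
  consider "finite {..<\<alpha>}" | \<beta> f where "\<beta> < \<alpha>" "bij_betw f {..<\<beta>} {..<\<alpha>}"
    | "infinite {..<\<alpha>}" "\<nexists>\<beta> f. \<beta> < \<alpha> \<and> bij_betw f {..<\<beta>} {..<\<alpha>}"
    by blast
  thus ?case
  proof cases
    case 1
    thus ?thesis using less.prems(4) by blast
  next
    case (2 \<beta> f)
    have f: "f i < \<alpha>" if "i < \<beta>" for i
      using 2(2) that by (auto simp: bij_betw_def)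
    have "|{..<\<beta>}| \<le>o \<kappa>"
      using 2(1) less.prems(1)
      by (meson card_of_mono1 lessThan_subset_iff less_imp_le ordLeq_transitive)
    moreover have "disjoint_family_on (\<lambda>i. D (f i)) {..<\<beta>}"
      using 2(2) less.prems(3) f unfolding disjoint_family_on_def bij_betw_def inj_on_def
      by (metis lessThan_iff)
    moreover have "m (\<Union>i\<in>J. D (f i)) \<le> b" if "finite J" "J \<subseteq> {..<\<beta>}" for J
      using less.prems(4)[of "f ` J"] that f by auto
    ultimately have "m (\<Union>i<\<beta>. D (f i)) \<le> b"
      using less.IH[OF 2(1), of "\<lambda>i. D (f i)"] less.prems(2) f by blast
    moreover have "(\<Union>i<\<beta>. D (f i)) = (\<Union>i<\<alpha>. D i)"
      using 2(2) by (simp add: bij_betw_def flip: image_image)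
    ultimately show ?thesis by simp
  next
    case 3
    have lim: "limit_ord \<alpha>"
      unfolding limit_ord_def
    proof (intro conjI allI impI)
      show "{..<\<alpha>} \<noteq> {}" using 3(1) by force
      fix \<beta> assume "\<beta> < \<alpha>"
      show "\<exists>\<delta><\<alpha>. \<beta> < \<delta>"
      proof (rule ccontr)
        assume "\<not> ?thesis"
        hence "i < \<alpha> \<longleftrightarrow> i = \<beta> \<or> i < \<beta>" for i
          using \<open>\<beta> < \<alpha>\<close> by (metis linorder_less_linear order_less_trans)
        hence eq: "{..<\<alpha>} = insert \<beta> {..<\<beta>}"
          by auto
        \<comment> \<open>One more element does not change an infinite cardinality, so a successor
          \<alpha> would be equinumerous with its predecessor \<beta>, which this case
          excludes.\<close>
        hence "infinite {..<\<beta>}"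
          using 3(1) by simp
        then obtain f where "bij_betw f {..<\<beta>} {..<\<alpha>}"
          using infinite_imp_bij_betw2[of "{..<\<beta>}" \<beta>] eq by auto
        thus False using 3(2) \<open>\<beta> < \<alpha>\<close> by blast
      qed
    qed
    let ?s = "(\<lambda>i. \<mu> (D i)) |` {..<\<alpha>}"
    \<comment> \<open>M4 also applies to every initial segment, so all partial sums are defined, as
      S2 requires cofinally, and are measures of initial unions.\<close>
    have seg: "?s |` {..<\<beta>} \<in> dom Sum \<and> \<mu> (\<Union>i<\<beta>. D i) = Sum (?s |` {..<\<beta>})"
      "|{..<\<beta>}| \<le>o \<kappa>" if "\<beta> \<le> \<alpha>" for \<beta>
    proof -
      show *: "|{..<\<beta>}| \<le>o \<kappa>"
        using that less.prems(1)
        by (meson card_of_mono1 lessThan_subset_iff ordLeq_transitive)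
      have "?s |` {..<\<beta>} = (\<lambda>i. \<mu> (D i)) |` {..<\<beta>}"
        using that by (auto simp: restrict_map_def fun_eq_iff)
      moreover have "disjoint_family_on D {..<\<beta>}"
        using less.prems(3) that by (auto simp: disjoint_family_on_def)
      ultimately show "?s |` {..<\<beta>} \<in> dom Sum \<and> \<mu> (\<Union>i<\<beta>. D i) = Sum (?s |` {..<\<beta>})"
        using M4[OF ord_of_less_cardSuc[OF card_\<kappa> *], of D] less.prems(2) that by auto
    qed
    have "\<mu> (D i) \<noteq> None" if "i < \<alpha>" for i
      using sets_in_dom less.prems(2) that by blast
    hence dom: "dom ?s = {..<\<alpha>}"
      by (auto simp: dom_def restrict_map_def)
    have s: "?s \<in> dom Sum" "\<mu> (\<Union>i<\<alpha>. D i) = Sum ?s"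
      using seg(1)[of \<alpha>] by auto
    have "isLub UNIV {the (Sum (?s |` {..<\<delta>})) | \<delta>. \<delta> < \<alpha> \<and> ?s |` {..<\<delta>} \<in> dom Sum} (the (Sum ?s))"
    proof (intro S2[OF s(1) dom lim] allI impI)
      fix \<beta> assume "\<beta> < \<alpha>"
      thus "\<exists>\<delta><\<alpha>. \<beta> \<le> \<delta> \<and> ?s |` {..<\<delta>} \<in> dom Sum"
        using seg(1)[of \<beta>] by (intro exI[of _ \<beta>]) simp
    qed
    moreover have "isUb UNIV {the (Sum (?s |` {..<\<delta>})) | \<delta>. \<delta> < \<alpha> \<and> ?s |` {..<\<delta>} \<in> dom Sum} b"
      unfolding isUb_def setle_def
    proof (intro conjI ballI)
      fix v assume "v \<in> {the (Sum (?s |` {..<\<delta>})) | \<delta>. \<delta> < \<alpha> \<and> ?s |` {..<\<delta>} \<in> dom Sum}"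
      then obtain \<delta> where \<delta>: "\<delta> < \<alpha>" "v = the (Sum (?s |` {..<\<delta>}))"
        by blast
      have "m (\<Union>i<\<delta>. D i) \<le> b"
      proof (rule less.IH[OF \<delta>(1)])
        show "|{..<\<delta>}| \<le>o \<kappa>" using seg(2) \<delta>(1) by simp
        show "disjoint_family_on D {..<\<delta>}"
          using less.prems(3) \<delta>(1) by (auto simp: disjoint_family_on_def)
        show "\<forall>i<\<delta>. D i \<in> \<MM>" using less.prems(2) \<delta>(1) by auto
        show "m (\<Union>i\<in>J. D i) \<le> b" if "finite J" "J \<subseteq> {..<\<delta>}" for J
          using less.prems(4)[of J] that \<delta>(1) by force
      qed
      thus "v \<le> b" using \<delta> seg(1)[of \<delta>] by simp
    qed simp
    ultimately have "the (Sum ?s) \<le> b"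
      by (rule isLub_le_isUb)
    thus ?thesis
      using s(2) by simp
  qed
qed

lemma measure_Union_le:
  assumes "|\<F>| \<le>o \<kappa>" "\<F> \<subseteq> \<MM>" "disjoint \<F>"
    and "\<And>F. finite F \<Longrightarrow> F \<subseteq> \<F> \<Longrightarrow> m (\<Union>F) \<le> b"
  shows "m (\<Union>\<F>) \<le> b"
proof -
  obtain \<alpha> :: 'o and f where \<alpha>: "|{..<\<alpha>}| \<le>o \<kappa>" "bij_betw f {..<\<alpha>} \<F>"
    using ordinal_enumeration[OF assms(1)] by blast
  have "m (\<Union>i<\<alpha>. f i) \<le> b"
  proof (rule measure_UN_le[OF \<alpha>(1)])
    show "\<forall>i<\<alpha>. f i \<in> \<MM>"
      using \<alpha>(2) assms(2) by (auto simp: bij_betw_def)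
    show "disjoint_family_on f {..<\<alpha>}"
      using \<alpha>(2) assms(3) unfolding disjoint_family_on_def bij_betw_def inj_on_def pairwise_def disjnt_def
      by (metis imageI)
    show "m (\<Union>i\<in>J. f i) \<le> b" if "finite J" "J \<subseteq> {..<\<alpha>}" for J
      using assms(4)[of "f ` J"] that \<alpha>(2) by (auto simp: bij_betw_def)
  qed
  thus ?thesis using \<alpha>(2) by (simp add: bij_betw_def)
qed

lemma finite_Union_in_M: "finite F \<Longrightarrow> F \<subseteq> \<MM> \<Longrightarrow> \<Union>F \<in> \<MM>"
  using union_closed finite_card_le by blast

text \<open>Peeling off one set adds its measure on the left, in the shape of
  \<open>multiple_Suc\<close>, and \<open>plus_mono\<close> compares the summands.\<close>

lemma measure_finite_Union:
  assumes "finite F" "F \<subseteq> \<MM>" "disjoint F"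
  shows "(\<forall>B\<in>F. m B \<le> b) \<Longrightarrow> m (\<Union>F) \<le> multiple (card F) b"
    and "(\<forall>B\<in>F. b \<le> m B) \<Longrightarrow> multiple (card F) b \<le> m (\<Union>F)"
  using assms
proof (induction F)
  case empty
  { case 1 show ?case using M1 by simp }
  { case 2 show ?case using M1 by simp }
next
  case (insert B F)
  have Un: "m (B \<union> \<Union>F) = m B + m (\<Union>F)" if "insert B F \<subseteq> \<MM>" "disjoint (insert B F)"
    using that insert.hyps finite_Union_in_M[of F]
    by (intro measure_Un) (auto simp: pairwise_insert disjnt_def)
  { case 1
    thus ?case
      using Un insert.IH(1) insert.hyps by (auto simp: pairwise_insert intro: plus_mono)
  next
    case 2
    thus ?case
      using Un insert.IH(2) insert.hyps by (auto simp: pairwise_insert intro: plus_mono)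
  }
qed

lemma measure_Union_null:
  assumes "|\<F>| \<le>o \<kappa>" "\<F> \<subseteq> \<MM>" "disjoint \<F>" "\<And>F. F \<in> \<F> \<Longrightarrow> m F \<le> 0"
  shows "m (\<Union>\<F>) \<le> 0"
proof (rule measure_Union_le[OF assms(1-3)])
  fix F assume "finite F" "F \<subseteq> \<F>"
  thus "m (\<Union>F) \<le> 0"
    using measure_finite_Union(1)[of F 0] assms pairwise_subset[of disjnt \<F> F] by auto
qed

end

section \<open>Continuous measures on spaces of sequences\<close>

text \<open>Collects the hypotheses of the theorem and a measure that it denies; the goal inside is
  \<open>inconsistent\<close>.\<close>

locale sequence_measure_space =
  long_weak_measure_space \<kappa> "subtopology (bounded_topology \<gamma> A) X" \<MM> Sum \<mu>
  for \<kappa> :: "'l rel" and \<gamma> :: "'o::wellorder" and A :: "'a set" and X :: "('o \<rightharpoonup> 'a) set"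
    and \<MM> and Sum :: "('o \<rightharpoonup> 's::pos_tot_ordered_monoid) \<rightharpoonup> 's" and \<mu> +
  assumes X_seqs: "X \<subseteq> seqs \<gamma> A"
    and weight: "has_weight (subtopology (bounded_topology \<gamma> A) X) \<kappa>"
    and continuum_le: "ctwo ^c natLeq \<le>o \<kappa>"
    and singletons: "\<And>x. x \<in> X \<Longrightarrow> {x} \<in> \<MM> \<and> \<mu> {x} = Some 0"
begin

section \<open>Null sets and small cylinders\<close>

lemma topspace_X: "topspace (subtopology (bounded_topology \<gamma> A) X) = X"
  using X_seqs by (rule topspace_subtopology_bounded)

lemma whole_positive: "m X > 0"
  using M2 topspace_X by simp

lemma cyl_open: "x \<in> X \<Longrightarrow> \<alpha> < \<gamma> \<Longrightarrow> openin (subtopology (bounded_topology \<gamma> A) X) (cyl X x \<alpha>)"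
  using openin_cyl X_seqs by blast

lemma cyl_in_M: "x \<in> X \<Longrightarrow> \<alpha> < \<gamma> \<Longrightarrow> cyl X x \<alpha> \<in> \<MM>"
  using cyl_open open_sets by blast

text \<open>The set is a disjoint union of at most \<kappa> null singletons. With
  \<open>continuum_le\<close> this covers all sets of at most continuum many points.\<close>

lemma small_subsets_null:
  assumes "Y \<subseteq> X" "|Y| \<le>o \<kappa>"
  shows "Y \<in> \<MM>" "m Y \<le> 0"
proof -
  let ?\<F> = "(\<lambda>x. {x}) ` Y"
  have *: "|?\<F>| \<le>o \<kappa>"
    using card_of_image assms(2) ordLeq_transitive by blast
  have sub: "?\<F> \<subseteq> \<MM>"
    using singletons assms(1) by auto
  show "Y \<in> \<MM>"
    using union_closed[OF sub *] by simp
  have "m (\<Union>?\<F>) \<le> 0"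
    using singletons assms(1) by (intro measure_Union_null[OF * sub]) (auto simp: pairwise_def)
  thus "m Y \<le> 0" by simp
qed

text \<open>For \<gamma> = 0 only the empty sequence exists, so \<open>X\<close> would be finite and
  hence null, against M2.\<close>

lemma positive_length: "\<exists>\<epsilon>. \<epsilon> < \<gamma>"
proof (rule ccontr)
  assume "\<not> ?thesis"
  hence "X \<subseteq> {Map.empty}"
    using X_seqs by (auto simp: seqs_def)
  hence "finite X"
    by (rule finite_subset) simp
  hence "m X \<le> 0"
    using small_subsets_null(2)[OF order_refl finite_card_le] by blast
  thus False using whole_positive by simp
qed

lemma small_cyl:
  assumes "x \<in> X" "b > 0"
  shows "\<exists>\<alpha><\<gamma>. m (cyl X x \<alpha>) < b"
proof -
  let ?T = "subtopology (bounded_topology \<gamma> A) X"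
  obtain \<B> where \<B>: "topology_basis ?T \<B>" "|\<B>| =o \<kappa>"
    using weight unfolding has_weight_def by blast
  \<comment> \<open>The length \<gamma> is arbitrary, so the cylinders at \<open>x\<close> might be
    too many for M5. The basic sets around \<open>x\<close> form a local basis of size at most
    \<kappa>; a cylinder is then found inside a small one.\<close>
  let ?L = "{V \<in> \<B>. x \<in> V}"
  have "|?L| \<le>o |\<B>|"
    by (rule card_of_mono1) auto
  hence "|?L| \<le>o \<kappa>"
    using \<B>(2) ordLeq_ordIso_trans by blast
  then obtain \<alpha> :: 'o and f where \<alpha>: "|{..<\<alpha>}| \<le>o \<kappa>" "bij_betw f {..<\<alpha>} ?L"
    using ordinal_enumeration by blast
  hence img: "f ` {..<\<alpha>} = ?L"
    by (simp add: bij_betw_def)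
  have "open_local_basis ?T x (f ` {..<\<alpha>})"
    using \<B>(1) unfolding img open_local_basis_def topology_basis_def by blast
  hence glb: "isGlb UNIV ((\<lambda>i. m (f i)) ` {..<\<alpha>}) 0"
    using M5[OF _ _ ord_of_less_cardSuc[OF card_\<kappa> \<alpha>(1)], of x f] singletons[OF assms(1)]
      assms(1) unfolding topspace_X by simp
  have "\<exists>i<\<alpha>. m (f i) < b"
  proof (rule ccontr)
    assume "\<not> ?thesis"
    hence "b \<le> m (f i)" if "i < \<alpha>" for i
      using that by (meson not_less)
    hence "isLb UNIV ((\<lambda>i. m (f i)) ` {..<\<alpha>}) b"
      by (auto simp: isLb_def setge_def)
    hence "b \<le> 0"
      using glb by (auto simp: isGlb_def greatestP_def setle_def)
    thus False using assms(2) by simp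
  qed
  then obtain V where V: "V \<in> ?L" "m V < b"
    using img by blast
  hence op: "openin ?T V"
    using \<B>(1) by (auto simp: topology_basis_def)
  obtain \<beta> where \<beta>: "\<beta> < \<gamma>" "cyl X x \<beta> \<subseteq> V"
    using open_contains_cyl[OF X_seqs op] V positive_length by blast
  hence "m (cyl X x \<beta>) \<le> m V"
    using M3 cyl_in_M assms(1) op open_sets by blast
  thus ?thesis using \<beta>(1) V(2) by (intro exI[of _ \<beta>]) auto
qed

lemma cyl_images_card_le:
  assumes "disjoint (P ` W)" "\<forall>x\<in>W. x \<in> P x \<and> (\<exists>\<alpha><\<gamma>. P x = cyl X x \<alpha>)" "W \<subseteq> X"
  shows "|P ` W| \<le>o \<kappa>" "P ` W \<subseteq> \<MM>"
proof -
  have *: "openin (subtopology (bounded_topology \<gamma> A) X) F \<and> F \<noteq> {}" if "F \<in> P ` W" for F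
    using that assms cyl_open by (smt (verit) imageE empty_iff subsetD)
  show "|P ` W| \<le>o \<kappa>"
    using disjoint_open_card_le_weight[OF weight assms(1)] * by blast
  show "P ` W \<subseteq> \<MM>"
    using * open_sets by blast
qed

text \<open>Partition \<open>X\<close> into cylinders of measure below \<open>b\<close>: the finite
  subunions are bounded by multiples of \<open>b\<close>, hence by \<open>c\<close>, and so is their
  supremum.\<close>

lemma bounded_multiples_imp_whole_le:
  assumes "b > 0" "\<And>n. multiple n b \<le> c"
  shows "m X \<le> c"
proof -
  have "\<forall>x\<in>X. \<exists>\<alpha><\<gamma>. m (cyl X x \<alpha>) < b"
    using small_cyl assms(1) by blast
  then obtain P where
    P: "\<forall>x\<in>X. x \<in> P x \<and> m (P x) < b \<and> (\<exists>\<alpha><\<gamma>. P x = cyl X x \<alpha>)" and disj: "disjoint (P ` X)"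
    using cyl_partition[of X X \<gamma> "\<lambda>S. m S < b"] by auto
  have "\<forall>x\<in>X. x \<in> P x \<and> (\<exists>\<alpha><\<gamma>. P x = cyl X x \<alpha>)"
    using P by simp
  note * = cyl_images_card_le[OF disj this order_refl]
  have "m (\<Union>(P ` X)) \<le> c"
  proof (rule measure_Union_le[OF * disj])
    fix F assume F: "finite F" "F \<subseteq> P ` X"
    have "m (P x) \<le> b" if "x \<in> X" for x
      using P that by auto
    hence "\<forall>B\<in>F. m B \<le> b"
      using F(2) by blast
    moreover have "F \<subseteq> \<MM>"
      using F(2) *(2) by blast
    ultimately have "m (\<Union>F) \<le> multiple (card F) b"
      using F(1) pairwise_subset[OF disj F(2)] by (intro measure_finite_Union(1))
    thus "m (\<Union>F) \<le> c"
      using assms(2) by (rule order_trans)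
  qed
  moreover have "P x \<subseteq> X" if "x \<in> X" for x
    using P that cyl_subset by metis
  hence "\<Union>(P ` X) = X"
    using P by blast
  ultimately show ?thesis by simp
qed

text \<open>A locally null open set is null, being partitioned into at most \<kappa> null cylinders.
  The clause \<open>S \<subseteq> U\<close> in the selection makes these cover exactly
  \<open>U\<close>.\<close>

lemma null_cyls_union_null:
  assumes "U \<subseteq> X" "\<And>x. x \<in> U \<Longrightarrow> \<exists>\<alpha><\<gamma>. cyl X x \<alpha> \<subseteq> U \<and> m (cyl X x \<alpha>) \<le> 0"
  shows "U \<in> \<MM>" "m U \<le> 0"
proof -
  obtain P where
    P: "\<forall>x\<in>U. x \<in> P x \<and> (P x \<subseteq> U \<and> m (P x) \<le> 0) \<and> (\<exists>\<alpha><\<gamma>. P x = cyl X x \<alpha>)"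
    and disj: "disjoint (P ` U)"
    using cyl_partition[of U X \<gamma> "\<lambda>S. S \<subseteq> U \<and> m S \<le> 0"] assms by auto
  have "\<forall>x\<in>U. x \<in> P x \<and> (\<exists>\<alpha><\<gamma>. P x = cyl X x \<alpha>)"
    using P by simp
  note * = cyl_images_card_le[OF disj this assms(1)]
  have "\<Union>(P ` U) = U" using P by blast
  moreover have "m (\<Union>(P ` U)) \<le> 0"
    using P by (intro measure_Union_null[OF * disj]) auto
  ultimately show "U \<in> \<MM>" "m U \<le> 0"
    using union_closed[OF *(2,1)] by simp_all
qed

section \<open>The support and a countable sequence of scales\<close>

definition support :: "('o \<rightharpoonup> 'a) set" where
  "support = {x \<in> X. \<forall>\<alpha><\<gamma>. m (cyl X x \<alpha>) > 0}"

lemma support_nonempty: "support \<noteq> {}"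
proof
  assume "support = {}"
  hence "\<exists>\<alpha><\<gamma>. m (cyl X x \<alpha>) \<le> 0" if "x \<in> X" for x
    using that by (auto simp: support_def not_less)
  hence "\<exists>\<alpha><\<gamma>. cyl X x \<alpha> \<subseteq> X \<and> m (cyl X x \<alpha>) \<le> 0" if "x \<in> X" for x
    using that cyl_subset by meson
  hence "m X \<le> 0"
    by (rule null_cyls_union_null(2)[OF order_refl])
  thus False using whole_positive by simp
qed

text \<open>Infinitely many pieces would bound all multiples of \<open>b\<close> by the measure of
  \<open>N\<close>, hence that of \<open>X\<close> as well.\<close>

lemma finite_large_pieces:
  assumes "N \<in> \<MM>" "m N < m X" "\<F> \<subseteq> \<MM>" "disjoint \<F>" "\<Union>\<F> \<subseteq> N" "b > 0"
    and "\<And>F. F \<in> \<F> \<Longrightarrow> b \<le> m F"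
  shows "finite \<F>"
proof (rule ccontr)
  assume inf: "infinite \<F>"
  have "multiple n b \<le> m N" for n
  proof -
    obtain F where F: "F \<subseteq> \<F>" "finite F" "card F = n"
      using infinite_arbitrarily_large[OF inf] by blast
    have "multiple n b \<le> m (\<Union>F)"
      using measure_finite_Union(2)[of F b] F assms(3,7) pairwise_subset[OF assms(4) F(1)] by auto
    also have "\<dots> \<le> m N"
      using F assms(1,3,5) by (intro M3 finite_Union_in_M) auto
    finally show ?thesis .
  qed
  hence "m X \<le> m N"
    using bounded_multiples_imp_whole_le assms(6) by blast
  thus False using assms(2) by simp
qed

text \<open>The sequence consists of the measures of successive differences of cylinders shrinking
  at \<open>x\<close>. The cylinders themselves need not have measures with infimum 0, but
  infinitely many disjoint differences inside one small cylinder cannot all be large.\<close>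

lemma ex_null_sequence:
  assumes "x \<in> support" "\<alpha> < \<gamma>" "m (cyl X x \<alpha>) < m X"
  obtains e :: "nat \<Rightarrow> 's" where "\<And>n. e n > 0" "\<And>b. b > 0 \<Longrightarrow> \<exists>n. e n < b"
proof -
  have x: "x \<in> X" "\<And>\<beta>. \<beta> < \<gamma> \<Longrightarrow> m (cyl X x \<beta>) > 0"
    using assms(1) by (auto simp: support_def)
  have "\<exists>f. \<forall>n. (f n < \<gamma> \<and> \<alpha> \<le> f n) \<and> (m (cyl X x (f (Suc n))) < m (cyl X x (f n)) \<and> f n < f (Suc n))"
  proof (rule dependent_nat_choice)
    show "\<exists>\<beta>. \<beta> < \<gamma> \<and> \<alpha> \<le> \<beta>" using assms(2) by blast
    fix \<beta> assume \<beta>: "\<beta> < \<gamma> \<and> \<alpha> \<le> \<beta>"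
    \<comment> \<open>The cylinder of length \<beta> at the support point \<open>x\<close> has
      positive measure, which serves as the bound to undercut.\<close>
    then obtain \<delta> where \<delta>: "\<delta> < \<gamma>" "m (cyl X x \<delta>) < m (cyl X x \<beta>)"
      using small_cyl x by meson
    have "\<beta> < \<delta>"
    proof (rule ccontr)
      assume "\<not> \<beta> < \<delta>"
      hence "m (cyl X x \<beta>) \<le> m (cyl X x \<delta>)"
        using \<beta> \<delta>(1) x(1) by (intro M3 cyl_in_M cyl_antimono) auto
      thus False using \<delta>(2) by simp
    qed
    thus "\<exists>\<delta>. (\<delta> < \<gamma> \<and> \<alpha> \<le> \<delta>) \<and> m (cyl X x \<delta>) < m (cyl X x \<beta>) \<and> \<beta> < \<delta>"
      using \<beta> \<delta> by (intro exI[of _ \<delta>]) auto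
  qed
  then obtain f where f: "\<And>n. f n < \<gamma>" "\<And>n. \<alpha> \<le> f n"
    "\<And>n. m (cyl X x (f (Suc n))) < m (cyl X x (f n))" "\<And>n. f n < f (Suc n)"
    by blast
  define D where "D n = cyl X x (f n) - cyl X x (f (Suc n))" for n
  have Dopen: "D n \<in> \<MM>" for n
  proof -
    \<comment> \<open>A point of \<open>D n\<close> differs from \<open>x\<close> below
      \<open>f (Suc n)\<close> but not below \<open>f n\<close>; its cylinder of length
      \<open>f (Suc n)\<close> inherits both.\<close>
    have "openin (subtopology (bounded_topology \<gamma> A) X) (D n)"
    proof (subst openin_subopen, intro ballI)
      fix y assume y: "y \<in> D n"
      hence "y \<in> X" using cyl_subset by (auto simp: D_def)
      moreover have "cyl X y (f (Suc n)) \<subseteq> D n"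
        using y f(4)[of n] by (auto simp: D_def cyl_def)
      ultimately show "\<exists>V. openin (subtopology (bounded_topology \<gamma> A) X) V \<and> y \<in> V \<and> V \<subseteq> D n"
        using cyl_open[OF \<open>y \<in> X\<close> f(1)] mem_cyl[OF \<open>y \<in> X\<close>] by meson
    qed
    thus ?thesis by (rule open_sets)
  qed
  have Dpos: "m (D n) > 0" for n
  proof -
    have "D n \<union> cyl X x (f (Suc n)) = cyl X x (f n)"
      using cyl_antimono[OF less_imp_le[OF f(4)[of n]], of X x] by (auto simp: D_def)
    moreover have "D n \<inter> cyl X x (f (Suc n)) = {}"
      by (auto simp: D_def)
    ultimately have "m (cyl X x (f n)) = m (D n) + m (cyl X x (f (Suc n)))"
      using measure_Un[OF Dopen cyl_in_M[OF x(1) f(1)], of n "Suc n"] by simp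
    \<comment> \<open>There is no subtraction in the monoid: positivity follows because a summand 0
      would leave the two cylinders with equal measure.\<close>
    hence "m (D n) = 0 \<Longrightarrow> m (cyl X x (f n)) = m (cyl X x (f (Suc n)))"
      by simp
    hence "m (D n) \<noteq> 0"
      using f(3)[of n] by (metis less_irrefl)
    with zero_least[of "m (D n)"] show ?thesis
      by (metis le_neq_trans)
  qed
  have Ddisj: "D n \<inter> D k = {}" if "n < k" for n k
  proof -
    have "f (Suc n) \<le> f k"
      using that f(4) by (simp add: lift_Suc_mono_le less_imp_le)
    thus ?thesis
      using cyl_antimono[of "f (Suc n)" "f k" X x] by (auto simp: D_def)
  qed
  have Dne: "D n \<noteq> {}" for n
    using Dpos[of n] M1 by auto
  have inj: "inj D"
    using Ddisj Dne by (intro linorder_injI) (metis Int_absorb)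
  have "D n \<inter> D k = {}" if "D n \<noteq> D k" for n k
    using Ddisj[of n k] Ddisj[of k n] that by (cases n k rule: linorder_cases) auto
  hence disj: "disjoint (range D)"
    by (simp add: pairwise_def disjnt_def)
  have sub: "\<Union>(range D) \<subseteq> cyl X x \<alpha>"
    using cyl_antimono[OF f(2), of X x] by (auto simp: D_def)
  have "\<exists>n. m (D n) < b" if "b > 0" for b
  proof (rule ccontr)
    assume "\<not> ?thesis"
    hence "b \<le> m (D n)" for n
      by (meson not_less)
    hence "b \<le> m F" if "F \<in> range D" for F
      using that by blast
    moreover have "range D \<subseteq> \<MM>"
      using Dopen by blast
    ultimately have "finite (range D)"
      using finite_large_pieces[OF cyl_in_M[OF x(1) assms(2)] assms(3) _ disj sub \<open>b > 0\<close>] by simp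
    thus False using inj by (simp add: finite_image_iff)
  qed
  thus thesis
    by (rule that[OF Dpos])
qed

text \<open>
  At each scale \<open>e n\<close> only countably many cylinders of the partition of \<open>N\<close> have positive measure,
  and the points of the support are told apart by them, so there are at most continuum many.
\<close>

lemma cyl_null:
  assumes "x \<in> X" "\<alpha> < \<gamma>" "m (cyl X x \<alpha>) < m X"
    and e: "\<And>n. e n > (0::'s)" "\<And>b. b > 0 \<Longrightarrow> \<exists>n::nat. e n < b"
  shows "m (cyl X x \<alpha>) \<le> 0"
proof -
  define N where "N = cyl X x \<alpha>"
  have N: "N \<in> \<MM>" "N \<subseteq> X" "m N < m X"
    using cyl_in_M[OF assms(1,2)] assms(3) cyl_subset[of X x \<alpha>] by (simp_all add: N_def)
  have cyl_N: "cyl X y \<alpha> = N" if "y \<in> N" for y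
    using cyl_eq that unfolding N_def by blast
  have ex: "\<exists>\<beta><\<gamma>. cyl X y \<beta> \<subseteq> N \<and> m (cyl X y \<beta>) < e n" if y: "y \<in> N" for y n
  proof -
    obtain \<beta> where \<beta>: "\<beta> < \<gamma>" "m (cyl X y \<beta>) < e n"
      using small_cyl[of y "e n"] e(1) y N(2) by blast
    \<comment> \<open>Lengthening to at least \<alpha> places the small cylinder inside
      \<open>N\<close>.\<close>
    have "m (cyl X y (max \<alpha> \<beta>)) \<le> m (cyl X y \<beta>)"
      using \<beta>(1) assms(2) that N(2) by (intro M3 cyl_in_M cyl_antimono) auto
    moreover have "cyl X y (max \<alpha> \<beta>) \<subseteq> N"
      using cyl_antimono[of \<alpha> "max \<alpha> \<beta>" X y] cyl_N[OF that] by auto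
    ultimately show ?thesis
      using \<beta> assms(2) by (intro exI[of _ "max \<alpha> \<beta>"]) auto
  qed
  have "\<exists>P. (\<forall>y\<in>N. y \<in> P y \<and> (P y \<subseteq> N \<and> m (P y) < e n) \<and> (\<exists>\<beta><\<gamma>. P y = cyl X y \<beta>)) \<and> disjoint (P ` N)" for n
    using cyl_partition[of N X \<gamma> "\<lambda>S. S \<subseteq> N \<and> m S < e n"] ex N(2) by simp
  then obtain P where P: "\<And>n y. y \<in> N \<Longrightarrow> y \<in> P n y \<and> (P n y \<subseteq> N \<and> m (P n y) < e n) \<and> (\<exists>\<beta><\<gamma>. P n y = cyl X y \<beta>)"
    and disj: "\<And>n. disjoint (P n ` N)"
    by metis
  have "\<forall>y\<in>N. y \<in> P n y \<and> (\<exists>\<beta><\<gamma>. P n y = cyl X y \<beta>)" for n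
    using P by simp
  note PM = cyl_images_card_le(2)[OF disj this N(2)]
  define \<C> where "\<C> = (\<Union>n. {F \<in> P n ` N. m F > 0})"
  have "countable {F \<in> P n ` N. m F > 0}" for n
  proof -
    \<comment> \<open>Every positive measure is at least some \<open>e k\<close>, and only finitely
      many disjoint pieces of \<open>N\<close> reach a given \<open>e k\<close>.\<close>
    have "finite {F \<in> P n ` N. e k \<le> m F}" for k
    proof (rule finite_large_pieces[OF N(1) N(3) _ _ _ e(1)[of k]])
      show "{F \<in> P n ` N. e k \<le> m F} \<subseteq> \<MM>"
        using PM by blast
      show "disjoint {F \<in> P n ` N. e k \<le> m F}"
        by (rule pairwise_subset[OF disj]) blast
      show "\<Union>{F \<in> P n ` N. e k \<le> m F} \<subseteq> N"
        using P by blast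
    qed simp
    hence "countable (\<Union>k. {F \<in> P n ` N. e k \<le> m F})"
      by (simp add: countable_finite)
    moreover have "\<exists>k. e k \<le> m F" if "m F > 0" for F
      using e(2)[OF that] less_imp_le by blast
    hence "{F \<in> P n ` N. m F > 0} \<subseteq> (\<Union>k. {F \<in> P n ` N. e k \<le> m F})"
      by blast
    ultimately show ?thesis
      by (rule countable_subset[rotated])
  qed
  hence count: "countable \<C>"
    by (auto simp: \<C>_def)
  let ?Y = "N \<inter> support"
  have "|?Y| \<le>o ctwo ^c natLeq"
  proof (rule card_le_continuum[OF count])
    fix y z assume y: "y \<in> ?Y" and z: "z \<in> ?Y" and same: "\<forall>C\<in>\<C>. y \<in> C \<longleftrightarrow> z \<in> C"
    have yX: "y \<in> X" "\<And>\<beta>. \<beta> < \<gamma> \<Longrightarrow> m (cyl X y \<beta>) > 0"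
      using y by (auto simp: support_def)
    have zP: "z \<in> P n y" for n
    proof -
      have "m (P n y) > 0" using P[of y n] y yX(2) by auto
      hence "P n y \<in> \<C>" using y by (auto simp: \<C>_def)
      thus ?thesis using same P[of y n] y by blast
    qed
    have close: "z \<in> cyl X y \<beta>" if \<beta>: "\<beta> < \<gamma>" for \<beta>
    proof -
      \<comment> \<open>At a scale below the measure of the cylinder of length \<beta>, the piece
        around \<open>y\<close> is a cylinder of length at least \<beta>, and it contains
        \<open>z\<close>.\<close>
      obtain n where n: "e n < m (cyl X y \<beta>)"
        using e(2) yX(2) \<beta> by blast
      obtain \<delta> where \<delta>: "\<delta> < \<gamma>" "P n y = cyl X y \<delta>" "m (cyl X y \<delta>) < e n"
        using P[of y n] y by auto
      have "\<beta> \<le> \<delta>"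
      proof (rule ccontr)
        assume "\<not> \<beta> \<le> \<delta>"
        hence "m (cyl X y \<beta>) \<le> m (cyl X y \<delta>)"
          using \<beta> \<delta>(1) yX(1) by (intro M3 cyl_in_M cyl_antimono) auto
        thus False using n \<delta>(3) by simp
      qed
      thus ?thesis using zP[of n] \<delta>(2) cyl_antimono by blast
    qed
    show "y = z"
    proof (rule ccontr)
      assume "y \<noteq> z"
      then obtain \<delta> where \<delta>: "y \<delta> \<noteq> z \<delta>" by blast
      have "\<delta> < \<gamma>"
      proof (rule ccontr)
        assume "\<not> \<delta> < \<gamma>"
        hence "y \<delta> = None" "z \<delta> = None"
          using y z N(2) X_seqs by (auto simp: seqs_def)
        thus False using \<delta> by simp
      qed
      \<comment> \<open>Agreement at \<delta> requires a length above \<delta> and still below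
        \<gamma>. It exists since a cylinder of smaller measure than that of length \<delta> must be
        longer.\<close>
      then obtain \<beta> where \<beta>: "\<beta> < \<gamma>" "m (cyl X y \<beta>) < m (cyl X y \<delta>)"
        using small_cyl yX by blast
      have "\<not> \<delta> < \<beta>"
        using close[OF \<beta>(1)] \<delta> by (auto simp: cyl_def)
      hence "m (cyl X y \<delta>) \<le> m (cyl X y \<beta>)"
        using \<beta>(1) \<open>\<delta> < \<gamma>\<close> yX(1) by (intro M3 cyl_in_M cyl_antimono) auto
      thus False using \<beta>(2) by simp
    qed
  qed
  hence "|?Y| \<le>o \<kappa>"
    using continuum_le ordLeq_transitive by blast
  moreover have "?Y \<subseteq> X"
    using N(2) by blast
  ultimately have Y: "?Y \<in> \<MM>" "m ?Y \<le> 0"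
    by (simp_all add: small_subsets_null)
  \<comment> \<open>A null cylinder contains no support point, as it is also the cylinder of that
    length at each of its points.\<close>
  have "\<exists>\<beta><\<gamma>. cyl X y \<beta> \<subseteq> N - support \<and> m (cyl X y \<beta>) \<le> 0" if y: "y \<in> N - support" for y
  proof -
    obtain \<beta> where \<beta>: "\<beta> < \<gamma>" "m (cyl X y \<beta>) \<le> 0"
      using y N(2) by (auto simp: support_def not_less)
    let ?\<beta> = "max \<alpha> \<beta>"
    have b: "?\<beta> < \<gamma>" using \<beta>(1) assms(2) by auto
    have "m (cyl X y ?\<beta>) \<le> m (cyl X y \<beta>)"
      using b \<beta>(1) y N(2) by (intro M3 cyl_in_M cyl_antimono) auto
    hence null: "m (cyl X y ?\<beta>) \<le> 0" using \<beta>(2) by simp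
    have "cyl X y ?\<beta> \<subseteq> N"
      using cyl_antimono[of \<alpha> ?\<beta> X y] cyl_N[of y] y by auto
    moreover have "z \<notin> support" if "z \<in> cyl X y ?\<beta>" for z
    proof
      assume "z \<in> support"
      hence "0 < m (cyl X z ?\<beta>)"
        using b by (simp add: support_def)
      thus False
        using null cyl_eq[OF that] by simp
    qed
    ultimately have "cyl X y ?\<beta> \<subseteq> N - support"
      by blast
    thus ?thesis using b null by (intro exI[of _ ?\<beta>] conjI)
  qed
  moreover have "N - support \<subseteq> X"
    using N(2) by blast
  ultimately have U: "N - support \<in> \<MM>" "m (N - support) \<le> 0"
    using null_cyls_union_null[of "N - support"] by simp_all
  have "m (?Y \<union> (N - support)) = m ?Y + m (N - support)"
    using Y U by (intro measure_Un) auto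
  also have "\<dots> \<le> 0 + 0"
    using Y U by (intro plus_mono)
  finally have "m (?Y \<union> (N - support)) \<le> 0" by simp
  moreover have "?Y \<union> (N - support) = N" by blast
  ultimately show ?thesis by (simp add: N_def)
qed

text \<open>A small cylinder at a support point is null by \<open>cyl_null\<close>, yet positive by
  the choice of the point.\<close>

lemma inconsistent: False
proof -
  obtain x where x: "x \<in> support"
    using support_nonempty by blast
  hence "x \<in> X" by (simp add: support_def)
  then obtain \<alpha> where \<alpha>: "\<alpha> < \<gamma>" "m (cyl X x \<alpha>) < m X"
    using small_cyl whole_positive by blast
  show False
  proof (rule ex_null_sequence[OF x \<alpha>])
    fix e :: "nat \<Rightarrow> 's"
    assume "\<And>n. e n > 0" "\<And>b. b > 0 \<Longrightarrow> \<exists>n. e n < b"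
    hence "m (cyl X x \<alpha>) \<le> 0"
      by (rule cyl_null[OF \<open>x \<in> X\<close> \<alpha>])
    moreover have "0 < m (cyl X x \<alpha>)"
      using x \<alpha>(1) by (simp add: support_def)
    ultimately show False
      by simp
  qed
qed

end

theorem theorem1p3:
  fixes \<gamma> :: "'o::wellorder" and A :: "'a set" and X :: "('o \<rightharpoonup> 'a) set" and \<kappa> :: "'l rel"
  assumes "X \<subseteq> seqs \<gamma> A"
    and "has_weight (subtopology (bounded_topology \<gamma> A) X) \<kappa>"
    and "ctwo ^c natLeq \<le>o \<kappa>"
    and "cardSuc \<kappa> \<le>o (all_ords :: 'o rel)"
  shows "\<not> (\<exists>\<MM> (Sum :: ('o \<rightharpoonup> 's::pos_tot_ordered_monoid) \<rightharpoonup> 's) \<mu>.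
      continuous_weak_measure_space \<kappa> (subtopology (bounded_topology \<gamma> A) X) \<MM> Sum \<mu>)"
proof
  assume "\<exists>\<MM> (Sum :: ('o \<rightharpoonup> 's) \<rightharpoonup> 's) \<mu>.
      continuous_weak_measure_space \<kappa> (subtopology (bounded_topology \<gamma> A) X) \<MM> Sum \<mu>"
  then obtain \<MM> and Sum :: "('o \<rightharpoonup> 's) \<rightharpoonup> 's" and \<mu>
    where "continuous_weak_measure_space \<kappa> (subtopology (bounded_topology \<gamma> A) X) \<MM> Sum \<mu>"
    by blast
  then interpret continuous_weak_measure_space \<kappa> "subtopology (bounded_topology \<gamma> A) X" \<MM> Sum \<mu> .
  \<comment> \<open>Infinity of \<kappa>, demanded by the locale, comes from the continuum
    bound.\<close>
  have "natLeq \<le>o ctwo ^c natLeq"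
    by (rule ordLess_imp_ordLeq[OF ordLess_ctwo_cexp[OF natLeq_Card_order]])
  hence "natLeq \<le>o \<kappa>"
    using assms(3) ordLeq_transitive by blast
  then interpret sequence_measure_space \<kappa> \<gamma> A X \<MM> Sum \<mu>
    using assms continuous topspace_subtopology_bounded[OF assms(1)]
    by unfold_locales (auto simp: has_weight_def)
  show False by (rule inconsistent)
qed

end
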